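(* Let $E,A\in\mathbb{R}^{n\times n}$ with $E$ nonsingular. Then $(E,A)$ is admissible if and only if there exist $S,U,B\in\mathbb{R}^{n\times n}$ with $S$ invertible, $U^TU=I_n$, $B$ symmetric positive semidefinite and $\|B\|\le1$, such that $A=S^{-1}UBSE$.
   Context: A pair $(E,A)$ of real $n\times n$ matrices is regular if $\det(\lambda E-A)$ is not identically zero in $\lambda$; its finite eigenvalues are the roots of $\det(zE-A)$. The index of a regular pair is defined via the Weierstrass canonical form $E=W\operatorname{diag}(I_q,N)T$, $A=W\operatorname{diag}(J,I_{n-q})T$ ($N$ nilpotent) as the nilpotency degree of $N$ if $q<n$, and $0$ if $E$ is nonsingular. The pair is stable if all finite eigenvalues lie in the closed unit disk and those on the unit circle are semisimple, and admissible if it is regular, of index at most one, and stable. $\|\cdot\|$ is the spectral norm. *)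

theory Defs
  imports "HOL-Analysis.Analysis" "HOL-Computational_Algebra.Polynomial"
begin

fun mat_pow :: "'a::semiring_1^'n^'n \<Rightarrow> nat \<Rightarrow> 'a^'n^'n" where
  "mat_pow N 0 = mat 1"
| "mat_pow N (Suc k) = N ** mat_pow N k"

definition cmat :: "real^'n^'m \<Rightarrow> complex^'n^'m" where
  "cmat M = (\<chi> i j. complex_of_real (M $ i $ j))"

definition pencil_poly :: "real^'n^'n \<Rightarrow> real^'n^'n \<Rightarrow> complex poly" where
  "pencil_poly E A = det (\<chi> i j. [: - complex_of_real (A $ i $ j), complex_of_real (E $ i $ j) :])"

definition regular_pair :: "real^'n^'n \<Rightarrow> real^'n^'n \<Rightarrow> bool" where
  "regular_pair E A \<longleftrightarrow> pencil_poly E A \<noteq> 0"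

definition finite_eigenvalue :: "real^'n^'n \<Rightarrow> real^'n^'n \<Rightarrow> complex \<Rightarrow> bool" where
  "finite_eigenvalue E A z \<longleftrightarrow> poly (pencil_poly E A) z = 0"

definition semisimple_eigenvalue :: "real^'n^'n \<Rightarrow> real^'n^'n \<Rightarrow> complex \<Rightarrow> bool" where
  "semisimple_eigenvalue E A z \<longleftrightarrow>
     order z (pencil_poly E A) = vec.dim {x :: complex^'n. (\<chi> i j. z * cmat E $ i $ j - cmat A $ i $ j) *v x = 0}"

definition stable_pair :: "real^'n^'n \<Rightarrow> real^'n^'n \<Rightarrow> bool" where
  "stable_pair E A \<longleftrightarrow>
     (\<forall>z. finite_eigenvalue E A z \<longrightarrow>
          cmod z \<le> 1 \<and> (cmod z = 1 \<longrightarrow> semisimple_eigenvalue E A z))"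

(* Weierstrass canonical form E = W diag(I_q, N) T, A = W diag(J, I_{n-q}) T.
   The index set is split into Q (the first block, |Q| = q) and its complement;
   since the ordering of the index type is immaterial (a permutation can be
   absorbed into W and T), the blocks are described by the subset Q. *)
definition weierstrass_form ::
  "real^'n^'n \<Rightarrow> real^'n^'n \<Rightarrow> real^'n^'n \<Rightarrow> real^'n^'n \<Rightarrow> 'n set \<Rightarrow> real^'n^'n \<Rightarrow> real^'n^'n \<Rightarrow> bool" where
  "weierstrass_form E A W T Q J N \<longleftrightarrow>
     invertible W \<and> invertible T \<and>
     (\<forall>i j. J $ i $ j \<noteq> 0 \<longrightarrow> i \<in> Q \<and> j \<in> Q) \<and>
     (\<forall>i j. N $ i $ j \<noteq> 0 \<longrightarrow> i \<notin> Q \<and> j \<notin> Q) \<and>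
     (\<exists>k. mat_pow N k = 0) \<and>
     E = W ** ((\<chi> i j. if i = j \<and> i \<in> Q then 1 else 0) + N) ** T \<and>
     A = W ** (J + (\<chi> i j. if i = j \<and> i \<notin> Q then 1 else 0)) ** T"

(* index: nilpotency degree of N if q < n (i.e. E singular), 0 if E nonsingular *)
definition pair_index :: "real^'n^'n \<Rightarrow> real^'n^'n \<Rightarrow> nat" where
  "pair_index E A =
     (if invertible E then 0
      else (LEAST k. \<exists>W T Q J N. weierstrass_form E A W T Q J N \<and> mat_pow N k = 0))"

definition admissible_pair :: "real^'n^'n \<Rightarrow> real^'n^'n \<Rightarrow> bool" where
  "admissible_pair E A \<longleftrightarrow> regular_pair E A \<and> pair_index E A \<le> 1 \<and> stable_pair E A"

definition spectral_norm :: "real^'n^'n \<Rightarrow> real" where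
  "spectral_norm B = onorm (\<lambda>x. B *v x)"

end

theory Submission
  imports Defs "HOL-Computational_Algebra.Fundamental_Theorem_Algebra"
begin

text \<open>Put \<open>M = A E\<^sup>-\<^sup>1\<close>. Since every square matrix has a polar decomposition, the representation
  \<open>A = S\<^sup>-\<^sup>1 U B S E\<close> says that \<open>M\<close> is similar to a contraction. For a contraction, eigenvalues
  lie in the closed unit disk, and a Jordan chain of length two at an eigenvalue of modulus one would
  have an unbounded orbit. Conversely, for an admissible pair every linear functional \<open>y\<close> is
  annihilated by a polynomial in the transpose of \<open>M\<close>, and splitting off its roots one at a time
  yields a positive semidefinite quadratic form that dominates \<open>\<bar>y x\<bar>\<^sup>2\<close> and does not increase
  under \<open>M\<close>. Summing over the coordinate functionals gives an inner product for which \<open>M\<close> is a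
  contraction.\<close>

subsection \<open>Semisimple eigenvalues of a matrix pencil\<close>

lemma poly_det:
  fixes M :: "'a::comm_ring_1 poly^'n^'n"
  shows "poly (det M) x = det (\<chi> i j. poly (M $ i $ j) x)"
  by (simp add: det_def poly_sum poly_prod)

lemma det_scale_columns:
  fixes M :: "'a::comm_ring_1^'n^'n"
  shows "det (\<chi> i j. c j * M $ i $ j) = (\<Prod>j\<in>UNIV. c j) * det M"
proof -
  have "det (\<chi> i j. c j * M $ i $ j) = det (transpose (\<chi> i j. c j * M $ i $ j))"
    by simp
  also have "transpose (\<chi> i j. c j * M $ i $ j) = (\<chi> j. c j *s (transpose M $ j))"
    by (simp add: transpose_def vec_eq_iff)
  also have "det \<dots> = (\<Prod>j\<in>UNIV. c j) * det (\<chi> j. transpose M $ j)"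
    by (rule det_rows_mul)
  finally show ?thesis by simp
qed

text \<open>A basis \<open>B0\<close> of \<open>K\<close> is extended to a basis \<open>B\<close> of
  the whole space, and \<open>P\<close> is the matrix of a linear bijection \<open>g\<close>
  carrying the standard basis onto \<open>B\<close>. The set \<open>I\<close> collects the
  coordinates whose images land in \<open>B0\<close>. This turns a kernel into a coordinate
  subspace, so that single columns of a determinant can be treated.\<close>

lemma subspace_adapted_matrix:
  fixes K :: "('a::field^'n) set"
  assumes "vec.subspace K"
  obtains P :: "'a^'n^'n" and I where "invertible P" "card I = vec.dim K"
    "K = {P *v u |u. \<forall>j. j \<notin> I \<longrightarrow> u $ j = 0}"
proof -
  obtain B0 where B0: "B0 \<subseteq> K" "vec.independent B0" "K \<subseteq> vec.span B0" "card B0 = vec.dim K"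
    using vec.basis_exists by blast
  have spB0: "vec.span B0 = K"
    using B0 assms vec.span_minimal by blast
  obtain B where B: "B0 \<subseteq> B" "vec.independent B" "vec.span B = UNIV"
    using vec.maximal_independent_subset_extend[of B0 UNIV] B0(2) by (metis subset_UNIV top.extremum_uniqueI)
  obtain g :: "'a^'n \<Rightarrow> 'a^'n" where g: "Vector_Spaces.linear (*s) (*s) g" "bij g"
      "bij_betw g cart_basis B"
    using vec.basis_change_exists'[OF independent_cart_basis B(2) span_cart_basis B(3)] by blast
  interpret g: Vector_Spaces.linear "(*s)" "(*s)" g by fact
  define P where "P = matrix g"
  define I where "I = {i. g (axis i 1) \<in> B0}"
  have Pg: "P *v u = g u" for u
    unfolding P_def using g(1) by (rule matrix_works)
  have P: "invertible P"
    unfolding invertible_eq_bij using g(2) Pg by (simp add: bij_def inj_on_def image_def)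
  have im: "g ` (\<lambda>i. axis i 1) ` I = B0"
  proof
    show "B0 \<subseteq> g ` (\<lambda>i. axis i 1) ` I"
    proof
      fix b assume b: "b \<in> B0"
      then have "b \<in> g ` cart_basis" using B(1) g(3) by (auto simp: bij_betw_def)
      then obtain i where "b = g (axis i 1)" by (auto simp: cart_basis_def)
      then show "b \<in> g ` (\<lambda>i. axis i 1) ` I" using b by (auto simp: I_def)
    qed
  qed (auto simp: I_def)
  have "inj_on (\<lambda>i. g (axis i 1)) I"
    using g(2) by (metis (mono_tags, lifting) axis_eq_axis bij_is_inj injD inj_onI zero_neq_one)
  then have cI: "card I = vec.dim K"
    using im B0(4) by (metis card_image image_image)
  have "K = {P *v u |u. \<forall>j. j \<notin> I \<longrightarrow> u $ j = 0}" (is "_ = ?R")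
  proof
    have "vec.span ((\<lambda>i. axis i 1) ` I) \<subseteq> {u::'a^'n. \<forall>j. j \<notin> I \<longrightarrow> u $ j = 0}"
      by (rule vec.span_minimal) (auto simp: axis_def vec.subspace_def)
    moreover have "K = g ` vec.span ((\<lambda>i. axis i 1) ` I)"
      using g.span_image[of "(\<lambda>i. axis i 1) ` I"] spB0 im by simp
    ultimately show "K \<subseteq> ?R" using Pg by fastforce
  next
    show "?R \<subseteq> K"
    proof safe
      fix u :: "'a^'n" assume u: "\<forall>j. j \<notin> I \<longrightarrow> u $ j = 0"
      have "u = (\<Sum>i\<in>UNIV. u $ i *s axis i 1)"
        by (simp add: basis_expansion)
      then have "g u = (\<Sum>i\<in>UNIV. u $ i *s g (axis i 1))"
        by (metis (no_types, lifting) g.sum g.scale sum.cong)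
      also have "\<dots> \<in> K"
      proof (rule vec.subspace_sum[OF assms])
        fix i show "u $ i *s g (axis i 1) \<in> K"
          using u B0(1) assms by (cases "i \<in> I") (auto simp: I_def vec.subspace_scale vec.subspace_0)
      qed
      finally show "P *v u \<in> K" by (simp add: Pg)
    qed
  qed
  with that P cI show thesis by blast
qed

text \<open>The body repeats the matrix in \<open>semisimple_eigenvalue\<close> literally, so the
  kernel there can be rewritten by unfolding.\<close>

definition pencil_at :: "real^'n^'n \<Rightarrow> real^'n^'n \<Rightarrow> complex \<Rightarrow> complex^'n^'n" where
  "pencil_at E A z = (\<chi> i j. z * cmat E $ i $ j - cmat A $ i $ j)"

lemma pencil_at_mult: "pencil_at E A z *v x = z *s (cmat E *v x) - cmat A *v x"
  by (simp add: pencil_at_def vec_eq_iff matrix_vector_mult_def sum_subtractf left_diff_distrib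
      sum_distrib_left mult.assoc)

lemma poly_pencil: "poly (pencil_poly E A) z = det (pencil_at E A z)"
  by (simp add: pencil_poly_def poly_det pencil_at_def cmat_def)

lemma det_0_iff_kernel:
  fixes M :: "'a::field^'n^'n"
  shows "det M = 0 \<longleftrightarrow> (\<exists>x. x \<noteq> 0 \<and> M *v x = 0)"
  using invertible_det_nz[of M] matrix_left_invertible_ker[of M] invertible_left_inverse[of M]
  by metis

text \<open>In a basis extending one of the kernel \<open>K\<close> of \<open>z E - A\<close>, the columns of \<open>x E - A\<close> that belong to
  \<open>K\<close> are divisible by \<open>x - z\<close>. Removing these factors leaves a matrix whose value \<open>D\<close> at \<open>x = z\<close>
  decides whether the order of \<open>z\<close> exceeds \<open>dim K\<close>.\<close>

lemma pencil_order_factor: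
  fixes E A :: "real^'n^'n" and z :: complex
  assumes nz: "pencil_poly E A \<noteq> 0"
  defines "K \<equiv> {x. pencil_at E A z *v x = 0}"
  obtains P :: "complex^'n^'n" and I and D :: "complex^'n^'n" where
    "invertible P" "K = {P *v u |u. \<forall>j. j \<notin> I \<longrightarrow> u $ j = 0}"
    "\<forall>u. D *v u = cmat E *v (P *v (\<chi> j. if j \<in> I then u $ j else 0))
        + pencil_at E A z *v (P *v (\<chi> j. if j \<in> I then 0 else u $ j))"
    "order z (pencil_poly E A) = vec.dim K \<longleftrightarrow> det D \<noteq> 0"
proof -
  have "vec.subspace K"
    by (auto simp: K_def vec.subspace_def vec.add vec.scale)
  then obtain P :: "complex^'n^'n" and I where P: "invertible P" "card I = vec.dim K"
      and K: "K = {P *v u |u. \<forall>j. j \<notin> I \<longrightarrow> u $ j = 0}"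
    by (rule subspace_adapted_matrix)
  define Rp where "Rp = (\<chi> i j. [: - complex_of_real (A $ i $ j), complex_of_real (E $ i $ j) :])"
  define Pp where "Pp = (\<chi> i j. [: P $ i $ j :])"
  define Dp where "Dp = (\<chi> i j. if j \<in> I then [: (cmat E ** P) $ i $ j :]
       else [: - (cmat A ** P) $ i $ j, (cmat E ** P) $ i $ j :])"
  define D where "D = (\<chi> i j. poly (Dp $ i $ j) z)"
  \<comment> \<open>The \<open>j\<close>-th column of \<open>P\<close> is a kernel vector of
    \<open>z E - A\<close>. Hence in column \<open>j\<close> of \<open>(x E - A) P\<close> the
    constant coefficient is \<open>-z\<close> times the linear one, which exhibits the factor
    \<open>x - z\<close>.\<close>
  have col: "(cmat A ** P) $ i $ j = z * (cmat E ** P) $ i $ j" if "j \<in> I" for i j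
  proof -
    have "P *v axis j 1 \<in> K" unfolding K using that by (auto simp: axis_def)
    then have "z *s (cmat E *v (P *v axis j 1)) = cmat A *v (P *v axis j 1)"
      by (simp add: K_def pencil_at_mult)
    then have "z *s ((cmat E ** P) *v axis j 1) = (cmat A ** P) *v axis j 1"
      by (simp add: matrix_vector_mul_assoc)
    then show ?thesis
      by (simp add: vec_eq_iff matrix_vector_mult_def axis_def if_distrib cong: if_cong)
  qed
  have RP: "(Rp ** Pp) $ i $ j = [: - (cmat A ** P) $ i $ j, (cmat E ** P) $ i $ j :]" for i j
  proof -
    have S: "(\<Sum>k\<in>S. [: f k, g k :]) = [: sum f S, sum g S :]" for S :: "'n set" and f g :: "'n \<Rightarrow> complex"
      by (induction S rule: infinite_finite_induct) auto
    have "(Rp ** Pp) $ i $ j = (\<Sum>k\<in>UNIV. [: - (complex_of_real (A $ i $ k) * P $ k $ j),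
        complex_of_real (E $ i $ k) * P $ k $ j :])"
      by (simp add: Rp_def Pp_def matrix_matrix_mult_def mult.commute)
    then show ?thesis
      unfolding S by (simp add: matrix_matrix_mult_def cmat_def sum_negf)
  qed
  have "Rp ** Pp = (\<chi> i j. (if j \<in> I then [:-z, 1:] else 1) * Dp $ i $ j)"
    unfolding vec_eq_iff RP by (auto simp: Dp_def col)
  then have "det (Rp ** Pp) = (\<Prod>j\<in>UNIV. if j \<in> I then [:-z, 1:] else 1) * det Dp"
    using det_scale_columns[of "\<lambda>j. if j \<in> I then [:-z, 1:] else 1" Dp] by (simp only:)
  then have "det Rp * det Pp = (\<Prod>j\<in>UNIV. if j \<in> I then [:-z, 1:] else 1) * det Dp"
    by (simp only: det_mul)
  also have "(\<Prod>j\<in>UNIV. if j \<in> I then [:-z, 1:] else 1) = [:-z, 1:] ^ card I"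
    by (simp add: prod.If_cases)
  finally have dets: "pencil_poly E A * det Pp = [:-z, 1:] ^ card I * det Dp"
    by (simp add: pencil_poly_def Rp_def)
  have polyP: "poly (det Pp) x = det P" for x
    by (simp add: poly_det Pp_def)
  have detP: "det P \<noteq> 0" using P(1) invertible_det_nz by blast
  have Pnz: "det Pp \<noteq> 0" using polyP detP by (metis poly_0)
  then have Dnz: "det Dp \<noteq> 0" using dets nz by auto
  \<comment> \<open>\<open>det Pp\<close> is a nonzero constant and contributes no order, while each
    extracted column factor contributes exactly one.\<close>
  have "order z (pencil_poly E A) = card I + order z (det Dp)"
  proof -
    have "order z (pencil_poly E A * det Pp) = order z (pencil_poly E A) + order z (det Pp)"
      using nz Pnz by (intro order_mult) simp
    moreover have "order z (det Pp) = 0" using polyP detP by (intro order_0I) simp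
    moreover have "order z ([:-z, 1:] ^ card I * det Dp) = card I + order z (det Dp)"
      using Dnz by (subst order_mult) (auto simp: order_power_n_n)
    ultimately show ?thesis using dets by simp
  qed
  then have ord: "order z (pencil_poly E A) = vec.dim K \<longleftrightarrow> det D \<noteq> 0"
    using order_eq_0_iff[OF Dnz, of z] by (simp add: P(2) D_def poly_det)
  have D: "D *v u = cmat E *v (P *v (\<chi> j. if j \<in> I then u $ j else 0))
        + pencil_at E A z *v (P *v (\<chi> j. if j \<in> I then 0 else u $ j))" for u
  proof -
    have "D $ i $ j * u $ j = (cmat E ** P) $ i $ j * (if j \<in> I then u $ j else 0)
       + (z * (cmat E ** P) $ i $ j - (cmat A ** P) $ i $ j) * (if j \<in> I then 0 else u $ j)" for i j
      by (simp add: D_def Dp_def)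
    then have "(\<Sum>j\<in>UNIV. D $ i $ j * u $ j) = (\<Sum>j\<in>UNIV. (cmat E ** P) $ i $ j * (if j \<in> I then u $ j else 0)
       + (z * (cmat E ** P) $ i $ j - (cmat A ** P) $ i $ j) * (if j \<in> I then 0 else u $ j))" for i
      by (simp only:)
    then show ?thesis
      unfolding pencil_at_mult unfolding matrix_vector_mul_assoc
      by (simp add: vec_eq_iff matrix_vector_mult_def sum.distrib sum_subtractf sum_distrib_left
          left_diff_distrib mult.assoc)
  qed
  show thesis by (rule that[OF P(1) K _ ord]) (use D in blast)
qed

text \<open>Equality of order and kernel dimension makes \<open>D\<close> invertible. Solving
  \<open>v = D u\<close> splits \<open>v\<close>: the coordinates of \<open>u\<close> in
  \<open>I\<close> give a kernel vector \<open>a\<close>, the others give \<open>w\<close>. So the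
  image of the kernel under \<open>E\<close> and the range of \<open>z E - A\<close> together span
  the space.\<close>

lemma semisimple_decomp:
  fixes E A :: "real^'n^'n"
  assumes nz: "pencil_poly E A \<noteq> 0" and ss: "semisimple_eigenvalue E A z"
  obtains a w where "pencil_at E A z *v a = 0" "v = cmat E *v a + pencil_at E A z *v w"
proof -
  obtain P :: "complex^'n^'n" and I and D :: "complex^'n^'n" where *: "invertible P"
    "{x. pencil_at E A z *v x = 0} = {P *v u |u. \<forall>j. j \<notin> I \<longrightarrow> u $ j = 0}"
    "\<forall>u. D *v u = cmat E *v (P *v (\<chi> j. if j \<in> I then u $ j else 0))
        + pencil_at E A z *v (P *v (\<chi> j. if j \<in> I then 0 else u $ j))"
    "order z (pencil_poly E A) = vec.dim {x. pencil_at E A z *v x = 0} \<longleftrightarrow> det D \<noteq> 0"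
    by (rule pencil_order_factor[OF nz, of z])
  have "det D \<noteq> 0"
    using *(4) ss by (simp add: semisimple_eigenvalue_def pencil_at_def)
  then have "surj ((*v) D)"
    using invertible_det_nz[of D] invertible_eq_bij[of D] by (simp add: bij_def)
  then obtain u where u: "v = D *v u" by (metis surjD)
  have "P *v (\<chi> j. if j \<in> I then u $ j else 0) \<in> {x. pencil_at E A z *v x = 0}"
    unfolding *(2) by auto
  then show thesis
    using that[OF _ u[unfolded *(3)[rule_format]]] by simp
qed

text \<open>A kernel vector of \<open>D\<close> encodes a Jordan chain of length two of the pencil.
  Excluding nonzero chains therefore makes \<open>D\<close> injective, and the order cannot exceed
  the kernel dimension.\<close>

lemma semisimpleI:
  fixes E A :: "real^'n^'n"
  assumes nz: "pencil_poly E A \<noteq> 0"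
    and chain: "\<And>a w. pencil_at E A z *v a = 0 \<Longrightarrow> pencil_at E A z *v w = cmat E *v a \<Longrightarrow> a = 0"
  shows "semisimple_eigenvalue E A z"
proof -
  obtain P :: "complex^'n^'n" and I and D :: "complex^'n^'n" where *: "invertible P"
    "{x. pencil_at E A z *v x = 0} = {P *v u |u. \<forall>j. j \<notin> I \<longrightarrow> u $ j = 0}"
    "\<forall>u. D *v u = cmat E *v (P *v (\<chi> j. if j \<in> I then u $ j else 0))
        + pencil_at E A z *v (P *v (\<chi> j. if j \<in> I then 0 else u $ j))"
    "order z (pencil_poly E A) = vec.dim {x. pencil_at E A z *v x = 0} \<longleftrightarrow> det D \<noteq> 0"
    by (rule pencil_order_factor[OF nz, of z])
  have injP: "x = y" if "P *v x = P *v y" for x y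
    using *(1) that by (meson inj_def inj_matrix_vector_mult)
  have "u = 0" if Du: "D *v u = 0" for u
  proof -
    define a where "a = (\<chi> j. if j \<in> I then u $ j else 0)"
    define w where "w = (\<chi> j. if j \<in> I then 0 else u $ j)"
    have Ra: "pencil_at E A z *v (P *v a) = 0"
    proof -
      have "P *v a \<in> {x. pencil_at E A z *v x = 0}"
        unfolding *(2) by (auto simp: a_def)
      then show ?thesis by simp
    qed
    \<comment> \<open>\<open>D u = 0\<close> says \<open>(z E - A) P w = - E P a\<close>; the sign
      is moved into \<open>w\<close> to match the chain hypothesis.\<close>
    have "pencil_at E A z *v (P *v (- w)) = cmat E *v (P *v a)"
      using Du *(3)[rule_format, of u] by (simp add: a_def[symmetric] w_def[symmetric] vec.neg neg_eq_iff_add_eq_0 add.commute)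
    then have Pa: "P *v a = 0" using chain Ra by blast
    then have a0: "a = 0" using injP[of a 0] by simp
    then have "pencil_at E A z *v (P *v w) = 0"
      using Du *(3)[rule_format, of u] by (simp add: a_def[symmetric] w_def[symmetric])
    then obtain u' where u': "P *v w = P *v u'" "\<forall>j. j \<notin> I \<longrightarrow> u' $ j = 0"
      using *(2) by fast
    \<comment> \<open>\<open>w\<close> vanishes on \<open>I\<close> by construction and
      \<open>u'\<close> vanishes off \<open>I\<close>, so their equality forces both to be
      zero.\<close>
    have "w = u'" using injP u'(1) by blast
    then have "w $ j = 0" for j using u'(2) by (cases "j \<in> I") (auto simp: w_def)
    moreover have "u $ j = a $ j + w $ j" for j by (simp add: a_def w_def)
    ultimately show "u = 0" using a0 by (simp add: vec_eq_iff)
  qed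
  then have "det D \<noteq> 0" unfolding det_0_iff_kernel by blast
  then show ?thesis using *(4) by (simp add: semisimple_eigenvalue_def pencil_at_def)
qed

subsection \<open>Polar decomposition and orthonormal bases\<close>

lemma compact_orthogonal_matrices: "compact {Q :: real^'n^'n. orthogonal_matrix Q}"
  unfolding compact_eq_bounded_closed
proof
  show "bounded {Q :: real^'n^'n. orthogonal_matrix Q}"
  proof (rule boundedI)
    fix Q :: "real^'n^'n" assume "Q \<in> {Q. orthogonal_matrix Q}"
    then have "norm (Q $ i) = 1" for i
      by (simp add: orthogonal_matrix_orthonormal_rows row_def)
    then show "norm Q \<le> (\<Sum>i\<in>(UNIV::'n set). 1)"
      using norm_le_l1_cart [of "\<chi> i. norm (Q $ i)"] by (simp add: norm_vec_def)
  qed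
  have "continuous_on UNIV (\<lambda>Q::real^'n^'n. transpose Q ** Q)"
    unfolding matrix_matrix_mult_def transpose_def by (intro continuous_intros)
  then show "closed {Q :: real^'n^'n. orthogonal_matrix Q}"
    unfolding orthogonal_matrix by (intro closed_Collect_eq continuous_on_const)
qed

text \<open>This is the Householder reflection \<open>I - 2 v v^T\<close>. In its square the two
  cross terms give \<open>-4 v v^T\<close>, cancelled by \<open>4 |v|^2 v v^T\<close> since
  \<open>v\<close> has norm one.\<close>

lemma orthogonal_reflection:
  fixes v :: "real^'n"
  assumes "norm v = 1"
  shows "orthogonal_matrix (mat 1 - (\<chi> i j. 2 * (v $ i * v $ j)))"
proof -
  have vv: "(\<Sum>k\<in>UNIV. v $ k * v $ k) = 1"
    using assms by (simp add: norm_eq_1 inner_vec_def)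
  let ?W = "mat 1 - (\<chi> i j. 2 * (v $ i * v $ j)) :: real^'n^'n"
  have "(transpose ?W ** ?W) $ i $ j = mat 1 $ i $ j" for i j
  proof -
    have "(transpose ?W ** ?W) $ i $ j = (\<Sum>k\<in>UNIV. (mat 1 $ k $ i - 2 * (v $ k * v $ i)) * (mat 1 $ k $ j - 2 * (v $ k * v $ j)))"
      by (simp add: matrix_matrix_mult_def transpose_def)
    also have "\<dots> = (\<Sum>k\<in>UNIV. mat 1 $ k $ i * mat 1 $ k $ j) - 2 * (v $ j * (\<Sum>k\<in>UNIV. mat 1 $ k $ i * v $ k))
       - 2 * (v $ i * (\<Sum>k\<in>UNIV. mat 1 $ k $ j * v $ k)) + 4 * (v $ i * v $ j * (\<Sum>k\<in>UNIV. v $ k * v $ k))"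
      by (simp add: sum_distrib_left sum_subtractf[symmetric] sum.distrib[symmetric] algebra_simps del: sum_subtractf sum.distrib)
    also have "\<dots> = mat 1 $ i $ j"
      unfolding vv by (simp add: mat_def if_distrib[of "\<lambda>x. x * _"] cong: if_cong)
    finally show ?thesis .
  qed
  then show ?thesis unfolding orthogonal_matrix by (simp add: vec_eq_iff)
qed

text \<open>A Givens rotation. Its derivative at \<open>t = 0\<close> is skew-symmetric with entries
  only at \<open>(q,p)\<close> and \<open>(p,q)\<close>, so varying \<open>t\<close> measures the
  asymmetry of a matrix at these two entries.\<close>

definition plane_rotation :: "'n \<Rightarrow> 'n \<Rightarrow> real \<Rightarrow> real^'n^'n" where
  "plane_rotation p q t = (\<chi> i j. if i = p then (if j = p then cos t else if j = q then - sin t else 0)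
      else if i = q then (if j = p then sin t else if j = q then cos t else 0)
      else if i = j then 1 else 0)"

lemma sum_remove_two:
  fixes f :: "'n::finite \<Rightarrow> real"
  assumes "p \<noteq> q"
  shows "(\<Sum>k\<in>UNIV. f k) = f p + f q + (\<Sum>k\<in>UNIV - {p, q}. f k)"
proof -
  have "(\<Sum>k\<in>UNIV. f k) = (\<Sum>k\<in>{p,q}. f k) + (\<Sum>k\<in>UNIV - {p, q}. f k)"
    by (metis Compl_eq_Diff_UNIV add.commute finite sum.subset_diff subset_UNIV)
  then show ?thesis using assms by simp
qed

lemma orthogonal_plane_rotation:
  assumes "p \<noteq> q"
  shows "orthogonal_matrix (plane_rotation p q t :: real^'n^'n)"
proof -
  let ?W = "plane_rotation p q t :: real^'n^'n"
  have cs: "cos t * cos t + sin t * sin t = 1"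
    by (metis sin_cos_squared_add3)
  have "(transpose ?W ** ?W) $ i $ j = mat 1 $ i $ j" for i j
  proof -
    have "(transpose ?W ** ?W) $ i $ j = (\<Sum>k\<in>UNIV. ?W $ k $ i * ?W $ k $ j)"
      by (simp add: matrix_matrix_mult_def transpose_def)
    also have "\<dots> = ?W $ p $ i * ?W $ p $ j + ?W $ q $ i * ?W $ q $ j + (\<Sum>k\<in>UNIV - {p,q}. ?W $ k $ i * ?W $ k $ j)"
      using assms by (rule sum_remove_two)
    also have "(\<Sum>k\<in>UNIV - {p,q}. ?W $ k $ i * ?W $ k $ j) = (\<Sum>k\<in>UNIV - {p,q}. if k = i then (if i = j then 1 else 0) else 0)"
      by (rule sum.cong) (auto simp: plane_rotation_def)
    also have "\<dots> = (if i \<in> UNIV - {p,q} \<and> i = j then 1 else 0)"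
      by (simp add: sum.delta)
    finally show ?thesis
      using assms cs by (auto simp: plane_rotation_def mat_def add.commute)
  qed
  then show ?thesis unfolding orthogonal_matrix by (simp add: vec_eq_iff)
qed

text \<open>Maximising \<open>trace (Q\<^sup>T K)\<close> over the orthogonal group yields the polar factor: comparing
  the maximum with reflections gives positivity, comparing it with plane rotations gives
  symmetry.\<close>

lemma polar_decomposition:
  fixes K :: "real^'n^'n"
  obtains U B where "orthogonal_matrix U" "transpose B = B" "\<forall>x. 0 \<le> x \<bullet> (B *v x)" "K = U ** B"
proof -
  have cont: "continuous_on {Q. orthogonal_matrix Q} (\<lambda>Q. trace (transpose Q ** K))"
    unfolding trace_def matrix_matrix_mult_def transpose_def by (intro continuous_intros)
  have "{Q :: real^'n^'n. orthogonal_matrix Q} \<noteq> {}"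
    using orthogonal_matrix_id by blast
  then obtain U where U: "orthogonal_matrix U"
    and max: "\<And>Q. orthogonal_matrix Q \<Longrightarrow> trace (transpose Q ** K) \<le> trace (transpose U ** K)"
    using continuous_attains_sup[OF compact_orthogonal_matrices _ cont] by auto
  define B where "B = transpose U ** K"
  have KB: "K = U ** B"
    using U by (simp add: B_def matrix_mul_assoc orthogonal_matrix_def)
  \<comment> \<open>The product \<open>U ** W\<close> is again orthogonal and competes with
    \<open>U\<close>; in terms of \<open>B\<close> the identity matrix becomes the
    maximiser.\<close>
  have maxB: "trace (transpose W ** B) \<le> trace B" if "orthogonal_matrix W" for W
    using max[of "U ** W"] U that
    by (simp add: orthogonal_matrix_mul B_def matrix_transpose_mul matrix_mul_assoc)
  have tr: "trace (transpose W ** B) = (\<Sum>i\<in>UNIV. \<Sum>k\<in>UNIV. W $ k $ i * B $ k $ i)" for W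
    by (simp add: trace_def matrix_matrix_mult_def transpose_def)
  have unit: "0 \<le> v \<bullet> (B *v v)" if "norm v = 1" for v
  proof -
    have "trace (transpose (mat 1 - (\<chi> i j. 2 * (v $ i * v $ j))) ** B)
        = trace B - 2 * (v \<bullet> (B *v v))"
    proof -
      have "trace (transpose (mat 1 - (\<chi> i j. 2 * (v $ i * v $ j))) ** B)
        = (\<Sum>i\<in>UNIV. \<Sum>k\<in>UNIV. mat 1 $ k $ i * B $ k $ i) - 2 * (\<Sum>i\<in>UNIV. \<Sum>k\<in>UNIV. v $ k * (B $ k $ i * v $ i))"
        unfolding tr by (simp add: sum_subtractf sum_distrib_left algebra_simps)
      also have "(\<Sum>i\<in>UNIV. \<Sum>k\<in>UNIV. v $ k * (B $ k $ i * v $ i)) = v \<bullet> (B *v v)"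
        by (subst sum.swap) (simp add: inner_vec_def matrix_vector_mult_def sum_distrib_left)
      also have "(\<Sum>i\<in>UNIV. \<Sum>k\<in>UNIV. mat 1 $ k $ i * B $ k $ i) = trace B"
        by (simp add: mat_def trace_def if_distrib[of "\<lambda>x. x * _"] cong: if_cong)
      finally show ?thesis .
    qed
    then show ?thesis
      using maxB[OF orthogonal_reflection[OF that]] by simp
  qed
  have psd: "0 \<le> x \<bullet> (B *v x)" for x
  proof (cases "x = 0")
    case False
    then have "0 \<le> (x /\<^sub>R norm x) \<bullet> (B *v (x /\<^sub>R norm x))"
      by (intro unit) simp
    also have "\<dots> = (x \<bullet> (B *v x)) / (norm x * norm x)"
      by (simp add: matrix_vector_mult_scaleR divide_inverse mult_ac)
    finally show ?thesis
      using False by (simp add: zero_le_divide_iff not_le[symmetric] power2_eq_square[symmetric])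
  qed simp
  have sym: "B $ q $ p = B $ p $ q" if "p \<noteq> q" for p q
  proof -
    define g where "g = (\<lambda>t. trace (transpose (plane_rotation p q t) ** B))"
    have g: "g t = cos t * (B $ p $ p + B $ q $ q) + sin t * (B $ q $ p - B $ p $ q)
        + (\<Sum>i\<in>UNIV - {p, q}. B $ i $ i)" for t
    proof -
      let ?W = "plane_rotation p q t"
      have "g t = (\<Sum>i\<in>UNIV. \<Sum>k\<in>UNIV. ?W $ k $ i * B $ k $ i)"
        unfolding g_def by (rule tr)
      also have "\<dots> = (\<Sum>k\<in>UNIV. ?W $ k $ p * B $ k $ p) + (\<Sum>k\<in>UNIV. ?W $ k $ q * B $ k $ q)
          + (\<Sum>i\<in>UNIV - {p, q}. \<Sum>k\<in>UNIV. ?W $ k $ i * B $ k $ i)"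
        using that by (rule sum_remove_two)
      also have "(\<Sum>i\<in>UNIV - {p, q}. \<Sum>k\<in>UNIV. ?W $ k $ i * B $ k $ i) = (\<Sum>i\<in>UNIV - {p, q}. B $ i $ i)"
      proof (rule sum.cong)
        fix i assume "i \<in> UNIV - {p, q}"
        then have "(\<Sum>k\<in>UNIV. ?W $ k $ i * B $ k $ i) = (\<Sum>k\<in>UNIV. if k = i then B $ i $ i else 0)"
          by (intro sum.cong) (auto simp: plane_rotation_def)
        then show "(\<Sum>k\<in>UNIV. ?W $ k $ i * B $ k $ i) = B $ i $ i" by simp
      qed simp
      also have "(\<Sum>k\<in>UNIV. ?W $ k $ p * B $ k $ p) = cos t * B $ p $ p + sin t * B $ q $ p"
        using that by (subst sum_remove_two[OF that]) (auto simp: plane_rotation_def intro!: sum.neutral)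
      also have "(\<Sum>k\<in>UNIV. ?W $ k $ q * B $ k $ q) = - sin t * B $ p $ q + cos t * B $ q $ q"
        using that by (subst sum_remove_two[OF that]) (auto simp: plane_rotation_def intro!: sum.neutral)
      finally show ?thesis by (simp add: algebra_simps)
    qed
    have "g t \<le> g 0" for t
    proof -
      have "plane_rotation p q 0 = (mat 1 :: real^'n^'n)"
        by (auto simp: plane_rotation_def mat_def vec_eq_iff)
      then show ?thesis
        using maxB[OF orthogonal_plane_rotation[OF that, of t]] by (simp add: g_def)
    qed
    moreover have "(g has_real_derivative B $ q $ p - B $ p $ q) (at 0)"
      unfolding g by (auto intro!: derivative_eq_intros)
    \<comment> \<open>The maximum at \<open>t = 0\<close> is interior, so the derivative vanishes.
      The cosine term has derivative zero there, which leaves only the coefficient of the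
      sine.\<close>
    ultimately have "B $ q $ p - B $ p $ q = 0"
      by (intro DERIV_local_max[of g _ 0 1]) auto
    then show ?thesis by simp
  qed
  have "transpose B = B"
    unfolding vec_eq_iff transpose_def using sym by (metis vec_lambda_beta)
  with U KB psd show thesis by (intro that[of U B]) auto
qed

text \<open>Gram-Schmidt for the inner product \<open>x^T P y\<close>: a
  \<open>P\<close>-orthonormal family is built by induction on its index set, and its vectors become
  the columns of \<open>T\<close>.\<close>

lemma gram_schmidt_form:
  fixes P :: "real^'n^'n"
  assumes sym: "transpose P = P" and pos: "\<And>x. x \<noteq> 0 \<Longrightarrow> 0 < x \<bullet> (P *v x)"
  obtains T :: "real^'n^'n" where "transpose T ** P ** T = mat 1"
proof -
  have comm: "x \<bullet> (P *v y) = y \<bullet> (P *v x)" for x y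
    using sym by (metis dot_lmul_matrix inner_commute vector_transpose_matrix)
  have ex: "\<exists>v. \<forall>i\<in>S. \<forall>j\<in>S. v i \<bullet> (P *v v j) = (if i = j then 1 else 0)" for S :: "'n set"
  proof (induction S rule: infinite_finite_induct)
    case (insert s S)
    then obtain v where v: "\<And>i j. i \<in> S \<Longrightarrow> j \<in> S \<Longrightarrow> v i \<bullet> (P *v v j) = (if i = j then 1 else 0)"
      by blast
    \<comment> \<open>As long as an index is missing, fewer than \<open>n\<close> vectors have been
      chosen, so some \<open>x\<close> lies outside their span and has a nonzero residual
      \<open>y\<close>.\<close>
    have "S \<noteq> UNIV" using insert by auto
    then have "card S < CARD('n)" by (simp add: psubset_card_mono psubsetI)
    then have "dim (v ` S) < CARD('n)"
      by (meson card_image_le dim_le_card' finite le_less_trans finite_imageI)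
    then have "span (v ` S) \<noteq> UNIV"
      by (metis dim_UNIV dim_span DIM_cart DIM_real mult.right_neutral less_irrefl)
    then obtain x where x: "x \<notin> span (v ` S)" by blast
    define y where "y = x - (\<Sum>i\<in>S. (v i \<bullet> (P *v x)) *\<^sub>R v i)"
    have "y \<noteq> 0"
    proof
      assume "y = 0"
      then have "x = (\<Sum>i\<in>S. (v i \<bullet> (P *v x)) *\<^sub>R v i)" by (simp add: y_def)
      also have "\<dots> \<in> span (v ` S)" by (intro span_sum span_scale span_base) auto
      finally show False using x by simp
    qed
    then have py: "0 < y \<bullet> (P *v y)" by (rule pos)
    have orth: "v j \<bullet> (P *v y) = 0" if "j \<in> S" for j
    proof -
      have "v j \<bullet> (P *v y) = v j \<bullet> (P *v x) - (\<Sum>i\<in>S. (v i \<bullet> (P *v x)) * (v j \<bullet> (P *v v i)))"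
        by (simp add: y_def matrix_vector_mult_diff_distrib inner_diff_right
            linear_sum[OF matrix_vector_mul_linear] inner_sum_right matrix_vector_mult_scaleR)
      also have "(\<Sum>i\<in>S. (v i \<bullet> (P *v x)) * (v j \<bullet> (P *v v i))) = (\<Sum>i\<in>S. if i = j then v i \<bullet> (P *v x) else 0)"
        using that v by (intro sum.cong) auto
      finally show ?thesis using that by simp
    qed
    define w where "w = y /\<^sub>R sqrt (y \<bullet> (P *v y))"
    have w: "w \<bullet> (P *v w) = 1"
      using py by (simp add: w_def matrix_vector_mult_scaleR field_simps)
    have w2: "v j \<bullet> (P *v w) = 0" if "j \<in> S" for j
      using orth[OF that] by (simp add: w_def matrix_vector_mult_scaleR)
    show ?case
    proof (intro exI ballI)
      fix i j assume "i \<in> insert s S" "j \<in> insert s S"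
      then show "(v(s := w)) i \<bullet> (P *v (v(s := w)) j) = (if i = j then 1 else 0)"
        using v[of i j] w w2[of i] w2[of j] comm[of w "v j"] insert(2) by (cases "i = s"; cases "j = s") simp_all
    qed
  qed auto
  obtain v :: "'n \<Rightarrow> real^'n" where "\<forall>i\<in>UNIV. \<forall>j\<in>UNIV. v i \<bullet> (P *v v j) = (if i = j then 1 else 0)"
    using ex[of UNIV] ..
  then have v: "v i \<bullet> (P *v v j) = (if i = j then 1 else 0)" for i j
    by simp
  have "transpose (\<chi> i j. v j $ i) ** P ** (\<chi> i j. v j $ i) = mat 1"
  proof -
    have "(transpose (\<chi> i j. v j $ i) ** (P ** (\<chi> i j. v j $ i))) $ i $ j = v i \<bullet> (P *v v j)" for i j
      by (simp add: matrix_matrix_mult_def matrix_vector_mult_def inner_vec_def transpose_def)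
    then show ?thesis by (simp add: vec_eq_iff v mat_def matrix_mul_assoc[symmetric])
  qed
  then show thesis by (rule that)
qed

subsection \<open>Quadratic forms that do not increase along orbits\<close>

text \<open>Horner's scheme for the vector \<open>p(N) y\<close>.\<close>

definition poly_act :: "complex^'n^'n \<Rightarrow> complex poly \<Rightarrow> complex^'n \<Rightarrow> complex^'n" where
  "poly_act N p y = fold_coeffs (\<lambda>a v. a *s y + N *v v) p 0"

lemma poly_act_0 [simp]: "poly_act N 0 y = 0"
  by (simp add: poly_act_def)

lemma poly_act_pCons [simp]: "poly_act N (pCons a p) y = a *s y + N *v poly_act N p y"
  by (cases "a = 0 \<and> p = 0") (auto simp: poly_act_def)

lemma poly_act_add: "poly_act N (p + q) y = poly_act N p y + poly_act N q y"
  by (induction p q rule: poly_induct2) (simp_all add: vec.add vec.scale_left_distrib add_ac)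

lemma poly_act_smult: "poly_act N (smult c p) y = c *s poly_act N p y"
  by (induction p) (simp_all add: vec.scale vec.scale_right_distrib)

lemma poly_act_sum: "poly_act N (\<Sum>i\<in>S. f i) y = (\<Sum>i\<in>S. poly_act N (f i) y)"
  by (induction S rule: infinite_finite_induct) (simp_all add: poly_act_add)

lemma poly_act_monom: "poly_act N (monom c i) y = c *s (((*v) N ^^ i) y)"
  by (induction i) (simp_all add: monom_0 monom_Suc vec.scale)

lemma poly_act_linear_factor: "poly_act N ([:- c, 1:] * q) y = N *v poly_act N q y - c *s poly_act N q y"
proof -
  have eq: "[:- c, 1:] * q = smult (- c) q + pCons 0 q" by simp
  show ?thesis unfolding eq poly_act_add poly_act_smult by simp
qed

lemma poly_act_diff_right: "poly_act N q (x - y) = poly_act N q x - poly_act N q y"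
  by (induction q) (simp_all add: vec.diff vec.scale_right_diff_distrib)

lemma poly_act_scale_right: "poly_act N q (c *s y) = c *s poly_act N q y"
  by (induction q) (simp_all add: vec.scale vec.scale_right_distrib mult.commute)

lemma poly_act_commute: "poly_act N q (N *v y) = N *v poly_act N q y"
  by (induction q) (simp_all add: vec.add vec.scale)

lemma poly_act_eigenvector:
  assumes "N *v z = c *s z"
  shows "poly_act N q z = poly q c *s z"
  by (induction q) (simp_all add: assms vec.scale vec.scale_left_distrib mult.commute)

text \<open>The \<open>n + 1\<close> vectors \<open>y, N y, ..., N^n y\<close> live in dimension
  \<open>n\<close>. If they are distinct, a linear dependence supplies the coefficients of
  \<open>q\<close>; if two coincide, the difference of the corresponding monomials serves.\<close>

lemma annihilating_poly_exists:
  fixes N :: "complex^'n^'n"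
  shows "\<exists>q. q \<noteq> 0 \<and> poly_act N q y = 0"
proof -
  define f where "f = (\<lambda>i. ((*v) N ^^ i) y)"
  let ?S = "{..CARD('n)}"
  show ?thesis
  proof (cases "inj_on f ?S")
    case True
    have "vec.dim (f ` ?S) \<le> CARD('n)" by (rule dim_subset_UNIV_cart_gen)
    then have "vec.dependent (f ` ?S)"
      by (intro vec.dependent_biggerset_general) (simp add: card_image[OF True])
    then obtain u j where u: "j \<in> ?S" "u (f j) \<noteq> 0" "(\<Sum>v\<in>f ` ?S. u v *s v) = 0"
      by (auto simp: vec.dependent_finite)
    define q where "q = (\<Sum>i\<in>?S. monom (u (f i)) i)"
    have "coeff q j = (\<Sum>i\<in>?S. if i = j then u (f i) else 0)"
      unfolding q_def coeff_sum coeff_monom by simp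
    then have "coeff q j \<noteq> 0" using u by simp
    then have "q \<noteq> 0" by auto
    moreover have "poly_act N q y = (\<Sum>i\<in>?S. u (f i) *s f i)"
      by (simp add: q_def poly_act_sum poly_act_monom f_def)
    then have "poly_act N q y = 0"
      using u(3) by (simp add: sum.reindex[OF True])
    ultimately show ?thesis by blast
  next
    case False
    then obtain i j where ij: "i \<noteq> j" "f i = f j" by (auto simp: inj_on_def)
    define q where "q = monom 1 i + monom (- 1 :: complex) j"
    have "coeff q i = 1" using ij(1) by (simp add: q_def)
    then have "q \<noteq> 0" by auto
    moreover have "poly_act N q y = 0"
      using ij(2) by (simp add: q_def poly_act_add poly_act_monom f_def vec.scale_minus_left)
    ultimately show ?thesis by blast
  qed
qed

text \<open>A complex functional on real vectors. The pairing is bilinear, without conjugation, so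
  the transpose of \<open>M\<close> and not the adjoint moves across it.\<close>

definition cpair :: "complex^'n \<Rightarrow> real^'n \<Rightarrow> complex" where
  "cpair y x = (\<Sum>i\<in>UNIV. y $ i * complex_of_real (x $ i))"

lemma cpair_add: "cpair (y + z) x = cpair y x + cpair z x"
  by (simp add: cpair_def sum.distrib distrib_right)

lemma cpair_diff: "cpair (y - z) x = cpair y x - cpair z x"
  by (simp add: cpair_def sum_subtractf left_diff_distrib)

lemma cpair_scale: "cpair (c *s y) x = c * cpair y x"
  by (simp add: cpair_def sum_distrib_left mult.assoc)

lemma cpair_transpose: "cpair (transpose (cmat M) *v y) x = cpair y (M *v x)"
  unfolding cpair_def matrix_vector_mult_def transpose_def cmat_def
  by (simp add: sum_distrib_left sum_distrib_right) (subst sum.swap, simp add: mult_ac)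

text \<open>The symmetric matrix is hidden in an existential, so that forms can be added and scaled
  as functions; it is extracted only once, for the final sum.\<close>

definition psd_form :: "(real^'n \<Rightarrow> real) \<Rightarrow> bool" where
  "psd_form h \<longleftrightarrow> (\<exists>P. transpose P = P \<and> (\<forall>x. h x = x \<bullet> (P *v x))) \<and> (\<forall>x. 0 \<le> h x)"

lemma psd_form_nonneg: "psd_form h \<Longrightarrow> 0 \<le> h x"
  by (simp add: psd_form_def)

lemma psd_form_zero: "psd_form (\<lambda>x. 0)"
  unfolding psd_form_def by (auto intro!: exI[of _ 0] simp: transpose_def vec_eq_iff)

lemma psd_form_add:
  assumes "psd_form g" "psd_form h"
  shows "psd_form (\<lambda>x. g x + h x)"
proof -
  obtain P Q where "transpose P = P" "\<And>x. g x = x \<bullet> (P *v x)"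
      "transpose Q = Q" "\<And>x. h x = x \<bullet> (Q *v x)"
    using assms unfolding psd_form_def by blast
  then have "transpose (P + Q) = P + Q \<and> (\<forall>x. g x + h x = x \<bullet> ((P + Q) *v x))"
    by (simp add: transpose_def vec_eq_iff matrix_vector_mult_add_rdistrib inner_add_right)
  then show ?thesis
    using assms psd_form_nonneg[of g] psd_form_nonneg[of h] unfolding psd_form_def
    by (metis add_nonneg_nonneg)
qed

lemma psd_form_scale:
  assumes "psd_form h" "0 \<le> c"
  shows "psd_form (\<lambda>x. c * h x)"
proof -
  obtain P where "transpose P = P" "\<And>x. h x = x \<bullet> (P *v x)"
    using assms unfolding psd_form_def by blast
  then have "transpose (c *\<^sub>R P) = c *\<^sub>R P \<and> (\<forall>x. c * h x = x \<bullet> ((c *\<^sub>R P) *v x))"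
    by (simp add: transpose_def vec_eq_iff scaleR_matrix_vector_assoc[symmetric])
  then show ?thesis
    using assms unfolding psd_form_def by (metis mult_nonneg_nonneg)
qed

lemma psd_form_sum: "(\<And>i. i \<in> S \<Longrightarrow> psd_form (h i)) \<Longrightarrow> psd_form (\<lambda>x. \<Sum>i\<in>S. h i x)"
  by (induction S rule: infinite_finite_induct) (auto intro: psd_form_zero psd_form_add)

text \<open>For real \<open>x\<close> the squared modulus is the sum of the squares of the real
  functionals \<open>Re y\<close> and \<open>Im y\<close>, so the matrix is a sum of two rank-one
  matrices.\<close>

lemma psd_form_cpair: "psd_form (\<lambda>x. (cmod (cpair y x))\<^sup>2)"
proof -
  define P where "P = (\<chi> i j. Re (y $ i) * Re (y $ j) + Im (y $ i) * Im (y $ j))"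
  have "transpose P = P" by (simp add: P_def transpose_def vec_eq_iff mult.commute)
  moreover have "(cmod (cpair y x))\<^sup>2 = x \<bullet> (P *v x)" for x
  proof -
    have "(cmod (cpair y x))\<^sup>2 = (\<Sum>i\<in>UNIV. Re (y $ i) * x $ i)\<^sup>2 + (\<Sum>i\<in>UNIV. Im (y $ i) * x $ i)\<^sup>2"
      by (simp add: cmod_power2 cpair_def)
    also have "\<dots> = x \<bullet> (P *v x)"
      unfolding power2_eq_square sum_product
      by (simp add: P_def inner_vec_def matrix_vector_mult_def sum_distrib_left sum.distrib[symmetric]
          algebra_simps del: sum.distrib)
    finally show ?thesis .
  qed
  ultimately show ?thesis unfolding psd_form_def by (metis zero_le_power2)
qed

text \<open>Such an \<open>h\<close> bounds the values \<open>|y (M^k x)|^2\<close> by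
  \<open>h x\<close> for all \<open>k\<close> at once.\<close>

definition lyap :: "real^'n^'n \<Rightarrow> complex^'n \<Rightarrow> bool" where
  "lyap M y \<longleftrightarrow> (\<exists>h. psd_form h \<and> (\<forall>x. h (M *v x) \<le> h x) \<and> (\<forall>x. (cmod (cpair y x))\<^sup>2 \<le> h x))"

text \<open>Telescoping along an orbit shows that even the sum of \<open>|y (M^k x)|^2\<close> over
  all \<open>k\<close> is at most \<open>h x\<close>.\<close>

definition strict_lyap :: "real^'n^'n \<Rightarrow> complex^'n \<Rightarrow> bool" where
  "strict_lyap M y \<longleftrightarrow> (\<exists>h. psd_form h \<and> (\<forall>x. h (M *v x) + (cmod (cpair y x))\<^sup>2 \<le> h x))"

lemma strict_lyap_imp_lyap:
  assumes "strict_lyap M y" shows "lyap M y"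
proof -
  obtain h where h: "psd_form h" "\<And>x. h (M *v x) + (cmod (cpair y x))\<^sup>2 \<le> h x"
    using assms unfolding strict_lyap_def by blast
  have "h (M *v x) \<le> h x" "(cmod (cpair y x))\<^sup>2 \<le> h x" for x
    using h(2)[of x] psd_form_nonneg[OF h(1), of "M *v x"] by (auto intro: order_trans[rotated])
  then show ?thesis unfolding lyap_def using h(1) by blast
qed

lemma lyap_add:
  assumes "lyap M y" "lyap M z" shows "lyap M (y + z)"
proof -
  obtain g h where g: "psd_form g" "\<And>x. g (M *v x) \<le> g x" "\<And>x. (cmod (cpair y x))\<^sup>2 \<le> g x"
    and h: "psd_form h" "\<And>x. h (M *v x) \<le> h x" "\<And>x. (cmod (cpair z x))\<^sup>2 \<le> h x"
    using assms unfolding lyap_def by blast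
  \<comment> \<open>The factor 2 comes from \<open>(a + b)^2 <= 2 (a^2 + b^2)\<close>.\<close>
  have "(cmod (cpair (y + z) x))\<^sup>2 \<le> 2 * (g x + h x)" for x
  proof -
    have "(cmod (cpair (y + z) x))\<^sup>2 \<le> (cmod (cpair y x) + cmod (cpair z x))\<^sup>2"
      by (simp add: cpair_add norm_triangle_ineq power_mono)
    also have "\<dots> \<le> 2 * ((cmod (cpair y x))\<^sup>2 + (cmod (cpair z x))\<^sup>2)"
      using sum_squares_bound[of "cmod (cpair y x)" "cmod (cpair z x)"] by (simp add: power2_sum)
    also have "\<dots> \<le> 2 * (g x + h x)"
      using g(3)[of x] h(3)[of x] by simp
    finally show ?thesis .
  qed
  then show ?thesis unfolding lyap_def
    using g h by (intro exI[of _ "\<lambda>x. 2 * (g x + h x)"]) (auto intro!: psd_form_scale psd_form_add add_mono)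
qed

lemma lyap_scale:
  assumes "lyap M y" shows "lyap M (c *s y)"
proof -
  obtain h where h: "psd_form h" "\<And>x. h (M *v x) \<le> h x" "\<And>x. (cmod (cpair y x))\<^sup>2 \<le> h x"
    using assms unfolding lyap_def by blast
  then show ?thesis unfolding lyap_def
    by (intro exI[of _ "\<lambda>x. (cmod c)\<^sup>2 * h x"])
      (auto intro!: psd_form_scale mult_left_mono simp: cpair_scale norm_mult power_mult_distrib)
qed

text \<open>The form \<open>|y x|^2\<close> itself works: \<open>M\<close> multiplies it by
  \<open>|c|^2\<close>.\<close>

lemma lyap_eigenvector:
  assumes "transpose (cmat M) *v y = c *s y" "cmod c \<le> 1"
  shows "lyap M y"
proof -
  have "(cmod (cpair y (M *v x)))\<^sup>2 \<le> (cmod (cpair y x))\<^sup>2" for x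
  proof -
    have "cpair y (M *v x) = c * cpair y x"
      using assms(1) by (metis cpair_transpose cpair_scale)
    then show ?thesis
      using assms(2) by (simp add: norm_mult mult_left_le_one_le power_mono)
  qed
  then show ?thesis unfolding lyap_def using psd_form_cpair by blast
qed

text \<open>The decrease of the form for \<open>N y - c y\<close> absorbs the cross terms in
  \<open>y (M x) = c (y x) + (N y - c y) x\<close>, where \<open>N\<close> is the transpose of \<open>M\<close>.\<close>

lemma strict_lyap_step:
  assumes c: "cmod c < 1" and y: "strict_lyap M (transpose (cmat M) *v y - c *s y)"
  shows "strict_lyap M y"
proof -
  define z where "z = transpose (cmat M) *v y - c *s y"
  obtain h where h: "psd_form h" "\<And>x. h (M *v x) + (cmod (cpair z x))\<^sup>2 \<le> h x"
    using y unfolding strict_lyap_def z_def by blast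
  define r where "r = cmod c"
  define k where "k = 1 / (1 - r)"
  have r: "0 \<le> r" "r < 1" using c by (auto simp: r_def)
  have k: "0 < k" "k * r + 1 = k" using r by (auto simp: k_def field_simps)
  \<comment> \<open>Convexity of the square: \<open>r s + t\<close> is the average of
    \<open>s\<close> and \<open>w = t / (1 - r)\<close> with weights \<open>r\<close> and
    \<open>1 - r\<close>. The defect is exactly \<open>r (1 - r) (s - w)^2\<close>.\<close>
  have conv: "(r * s + t)\<^sup>2 \<le> r * s\<^sup>2 + k * t\<^sup>2" for s t
  proof -
    define w where "w = k * t"
    have t: "t = (1 - r) * w" using r by (simp add: w_def k_def)
    have "k * t\<^sup>2 = w * t" by (simp add: w_def power2_eq_square)
    also have "\<dots> = w * ((1 - r) * w)" using t by (rule arg_cong)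
    finally have "r * s\<^sup>2 + k * t\<^sup>2 - (r * s + t)\<^sup>2
        = r * s\<^sup>2 + w * ((1 - r) * w) - (r * s + (1 - r) * w)\<^sup>2"
      using t by (simp only:)
    also have "\<dots> = r * (1 - r) * (s - w)\<^sup>2"
      by (simp add: power2_eq_square algebra_simps)
    also have "\<dots> \<ge> 0" using r by simp
    finally show ?thesis by simp
  qed
  \<comment> \<open>By \<open>conv\<close>, the first term of \<open>g\<close> at \<open>M x\<close>
    is at most \<open>k r |y x|^2 + k^2 |z x|^2\<close>. The decrease of \<open>k^2 h\<close> pays
    for the last summand, and \<open>k r = k - 1\<close> leaves one full \<open>|y x|^2\<close> to
    spare.\<close>
  define g where "g = (\<lambda>x. k * (cmod (cpair y x))\<^sup>2 + (k * k) * h x)"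
  have "psd_form g"
    unfolding g_def using h(1) k by (intro psd_form_add psd_form_scale psd_form_cpair) auto
  moreover have "g (M *v x) + (cmod (cpair y x))\<^sup>2 \<le> g x" for x
  proof -
    have "cpair y (M *v x) = c * cpair y x + cpair z x"
      by (simp add: z_def cpair_diff cpair_scale cpair_transpose del: transpose_matrix_vector)
    then have "cmod (cpair y (M *v x)) \<le> r * cmod (cpair y x) + cmod (cpair z x)"
      by (metis norm_triangle_ineq norm_mult r_def)
    then have "(cmod (cpair y (M *v x)))\<^sup>2 \<le> (r * cmod (cpair y x) + cmod (cpair z x))\<^sup>2"
      by (simp add: power_mono)
    also have "\<dots> \<le> r * (cmod (cpair y x))\<^sup>2 + k * (cmod (cpair z x))\<^sup>2" by (rule conv)
    finally have "k * (cmod (cpair y (M *v x)))\<^sup>2 \<le> k * (r * (cmod (cpair y x))\<^sup>2 + k * (cmod (cpair z x))\<^sup>2)"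
      using k(1) by simp
    moreover have "(k * k) * (h (M *v x) + (cmod (cpair z x))\<^sup>2) \<le> (k * k) * h x"
      using h(2)[of x] k(1) by simp
    ultimately have "g (M *v x) + (cmod (cpair y x))\<^sup>2 \<le> (k * r + 1) * (cmod (cpair y x))\<^sup>2 + (k * k) * h x"
      unfolding g_def by (simp add: algebra_simps)
    then show ?thesis unfolding k(2) g_def .
  qed
  ultimately show ?thesis unfolding strict_lyap_def by blast
qed

section \<open>Splitting off the roots of an annihilating polynomial\<close>

lemma poly_act_split_root:
  fixes q :: "complex poly"
  assumes "poly q c = 0" "q \<noteq> 0"
  obtains p where "q = [:- c, 1:] * p" "p \<noteq> 0" "degree p < degree q"
proof -
  obtain p where p: "q = [:- c, 1:] * p" using assms(1) unfolding poly_eq_0_iff_dvd by (rule dvdE)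
  then have "p \<noteq> 0" using assms(2) by auto
  moreover have "degree q = Suc (degree p)"
    unfolding p using calculation by (subst degree_mult_eq) auto
  ultimately show thesis using that p by simp
qed

lemma poly_act_degree_0:
  assumes "degree q = 0" "q \<noteq> 0" "poly_act N q y = 0"
  shows "y = 0"
proof -
  obtain c where "q = [:c:]" using assms(1) by (rule degree_eq_zeroE)
  then show ?thesis using assms by simp
qed

text \<open>If \<open>q = (X - c) p\<close> annihilates \<open>y\<close>, then \<open>p\<close>
  annihilates \<open>N y - c y\<close>. Induction on the degree gives a strict form for that
  functional, and \<open>strict_lyap_step\<close> lifts it to \<open>y\<close>.\<close>

lemma strict_lyap_annihilated:
  assumes "q \<noteq> 0" "\<And>c. poly q c = 0 \<Longrightarrow> cmod c < 1" "poly_act (transpose (cmat M)) q y = 0"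
  shows "strict_lyap M y"
  using assms
proof (induction "degree q" arbitrary: q y rule: less_induct)
  case less
  show ?case
  proof (cases "degree q = 0")
    case True
    then have "y = 0" using less.prems poly_act_degree_0 by blast
    then show ?thesis
      unfolding strict_lyap_def using psd_form_zero by (auto simp: cpair_def)
  next
    case False
    then obtain c where c: "poly q c = 0"
      using fundamental_theorem_of_algebra[of q] by (auto simp: constant_degree)
    then obtain p where p: "q = [:- c, 1:] * p" "p \<noteq> 0" "degree p < degree q"
      using less.prems(1) by (rule poly_act_split_root)
    define N where "N = transpose (cmat M)"
    have "poly_act N p (N *v y - c *s y) = 0"
      using less.prems(3) unfolding p(1) poly_act_linear_factor N_def[symmetric]
      by (simp add: poly_act_diff_right poly_act_commute poly_act_scale_right)
    moreover have "cmod d < 1" if "poly p d = 0" for d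
      using less.prems(2)[of d] that by (simp add: p(1))
    ultimately have "strict_lyap M (N *v y - c *s y)"
      using less.hyps[OF p(3) p(2)] unfolding N_def by blast
    then show ?thesis using strict_lyap_step[OF less.prems(2)[OF c]] by (simp only: N_def)
  qed
qed

text \<open>Roots on the unit circle have to be split off first: an eigenvector functional at such a root
  admits no strictly decreasing form, so it could not be absorbed by a later root.\<close>

lemma lyap_annihilated:
  fixes M :: "real^'n^'n"
  defines "N \<equiv> transpose (cmat M)"
  assumes eig: "\<And>c z. N *v z = c *s z \<Longrightarrow> z \<noteq> 0 \<Longrightarrow> cmod c \<le> 1"
    and semisimple: "\<And>c u. cmod c = 1 \<Longrightarrow> N *v (N *v u - c *s u) = c *s (N *v u - c *s u) \<Longrightarrow> N *v u = c *s u"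
    and "q \<noteq> 0" "poly_act N q y = 0"
  shows "lyap M y"
  using assms(4,5)
proof (induction "degree q" arbitrary: q y rule: less_induct)
  case less
  show ?case
  proof (cases "\<forall>c. poly q c = 0 \<longrightarrow> cmod c < 1")
    case True
    then show ?thesis
      using strict_lyap_imp_lyap strict_lyap_annihilated less.prems N_def by blast
  next
    case False
    then obtain c where c: "poly q c = 0" "1 \<le> cmod c" by auto
    then obtain p where p: "q = [:- c, 1:] * p" "p \<noteq> 0" "degree p < degree q"
      using less.prems(1) by (auto elim: poly_act_split_root)
    \<comment> \<open>\<open>(N - c) z = q(N) y = 0\<close>, so \<open>z\<close> is zero or an
      eigenvector. In the first case \<open>p\<close> already annihilates \<open>y\<close>; in the
      second the modulus of \<open>c\<close> must be one.\<close>
    define z where "z = poly_act N p y"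
    have z: "N *v z = c *s z"
      using less.prems(2) unfolding p(1) poly_act_linear_factor by (simp add: z_def)
    show ?thesis
    proof (cases "z = 0")
      case True
      then show ?thesis using less.hyps[OF p(3) p(2)] by (simp add: z_def)
    next
      case False
      then have c1: "cmod c = 1" using eig[OF z] c(2) by simp
      \<comment> \<open>A second factor \<open>X - c\<close> would put the eigenvector
        \<open>z\<close> into the range of \<open>N - c\<close>, which semisimplicity
        forbids.\<close>
      have "poly p c \<noteq> 0"
      proof
        assume "poly p c = 0"
        then obtain r where r: "p = [:- c, 1:] * r"
          using p(2) by (auto elim: poly_act_split_root)
        have "z = N *v poly_act N r y - c *s poly_act N r y"
          unfolding z_def r by (rule poly_act_linear_factor)
        then show False using semisimple[OF c1, of "poly_act N r y"] z False by simp
      qed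
      \<comment> \<open>Since \<open>p(N) z = p(c) z\<close> and \<open>z = p(N) y\<close>, this
        scaling makes \<open>p\<close> annihilate \<open>y - k z\<close>. The remaining part
        \<open>k z\<close> is handled as an eigenvector.\<close>
      define k where "k = 1 / poly p c"
      have "poly_act N p (y - k *s z) = 0"
        unfolding poly_act_diff_right poly_act_scale_right poly_act_eigenvector[OF z]
        using \<open>poly p c \<noteq> 0\<close> by (simp add: k_def z_def[symmetric])
      then have "lyap M (y - k *s z)" using less.hyps[OF p(3) p(2)] by blast
      moreover have "lyap M z" using lyap_eigenvector[of M z c] z c1 unfolding N_def by simp
      ultimately have "lyap M ((y - k *s z) + k *s z)" by (intro lyap_add lyap_scale)
      then show ?thesis by simp
    qed
  qed
qed

text \<open>The forms for the coordinate functionals are added up. Each dominates one squared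
  coordinate, so the sum is at least \<open>x^T x\<close>, which makes \<open>P\<close> positive
  definite and not merely semidefinite.\<close>

lemma stein_inequality_solvable:
  fixes M :: "real^'n^'n"
  defines "N \<equiv> transpose (cmat M)"
  assumes "\<And>c z. N *v z = c *s z \<Longrightarrow> z \<noteq> 0 \<Longrightarrow> cmod c \<le> 1"
    and "\<And>c u. cmod c = 1 \<Longrightarrow> N *v (N *v u - c *s u) = c *s (N *v u - c *s u) \<Longrightarrow> N *v u = c *s u"
  obtains P :: "real^'n^'n" where "transpose P = P" "\<And>x. x \<noteq> 0 \<Longrightarrow> 0 < x \<bullet> (P *v x)"
    "\<And>x. (M *v x) \<bullet> (P *v (M *v x)) \<le> x \<bullet> (P *v x)"
proof -
  have "lyap M y" for y
    using annihilating_poly_exists[of N y] lyap_annihilated[of M] assms unfolding N_def by blast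
  then have "\<forall>i. \<exists>h. psd_form h \<and> (\<forall>x. h (M *v x) \<le> h x) \<and> (\<forall>x. (cmod (cpair (axis i 1) x))\<^sup>2 \<le> h x)"
    unfolding lyap_def by blast
  then obtain h where h: "\<And>i. psd_form (h i)" "\<And>i x. h i (M *v x) \<le> h i x"
      "\<And>i x. (cmod (cpair (axis i 1) x))\<^sup>2 \<le> h i x"
    by metis
  define g where "g = (\<lambda>x. \<Sum>i\<in>UNIV. h i x)"
  have "psd_form g" unfolding g_def using h(1) by (rule psd_form_sum)
  then obtain P where P: "transpose P = P" "\<And>x. g x = x \<bullet> (P *v x)"
    unfolding psd_form_def by blast
  have "x \<bullet> x \<le> g x" for x
  proof -
    have "cpair (axis i 1) x = complex_of_real (x $ i)" for i
      by (simp add: cpair_def axis_def if_distrib[of "\<lambda>u. u * _"] cong: if_cong)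
    then have "x $ i * x $ i \<le> h i x" for i
      using h(3)[of i x] by (simp add: power2_eq_square)
    then show ?thesis unfolding g_def inner_vec_def by (simp add: sum_mono)
  qed
  then have "x \<noteq> 0 \<Longrightarrow> 0 < x \<bullet> (P *v x)" for x
    using P(2) by (metis inner_gt_zero_iff less_le_trans)
  moreover have "g (M *v x) \<le> g x" for x
    unfolding g_def by (intro sum_mono h(2))
  ultimately show thesis using that P by metis
qed

subsection \<open>Admissibility and similarity to a contraction\<close>

lemma matrix_inv_cancel:
  fixes A :: "'a::semiring_1^'n^'n"
  assumes "invertible A"
  shows "A ** matrix_inv A = mat 1" "matrix_inv A ** A = mat 1"
proof -
  have "\<exists>B. A ** B = mat 1 \<and> B ** A = mat 1" using assms by (simp add: invertible_def)
  from someI_ex[OF this] show "A ** matrix_inv A = mat 1" "matrix_inv A ** A = mat 1"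
    by (auto simp: matrix_inv_def)
qed

section \<open>Real matrices acting on complex vectors\<close>

lemma cmat_mult: "cmat (A ** B) = cmat A ** cmat B"
  by (simp add: cmat_def matrix_matrix_mult_def vec_eq_iff)

lemma cmat_one [simp]: "cmat (mat 1) = mat 1"
  by (simp add: cmat_def mat_def vec_eq_iff)

lemma inj_cmat:
  fixes T :: "real^'n^'n"
  assumes "invertible T" "cmat T *v x = 0"
  shows "x = 0"
proof -
  have "cmat (matrix_inv T) ** cmat T = mat 1"
    using matrix_inv_cancel(2)[OF assms(1)] by (metis cmat_mult cmat_one)
  then show ?thesis
    using assms(2) by (metis matrix_vector_mul_assoc matrix_vector_mul_lid matrix_vector_mult_0_right)
qed

lemma norm_scale_complex_vec: "norm (c *s (y :: complex^'n)) = cmod c * norm y"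
  by (simp add: norm_vec_def L2_set_def norm_mult power_mult_distrib sum_distrib_left[symmetric]
      real_sqrt_mult)

lemma norm_complex_vec_power2:
  fixes y :: "complex^'n"
  shows "(norm y)\<^sup>2 = (norm (\<chi> i. Re (y $ i)))\<^sup>2 + (norm (\<chi> i. Im (y $ i)))\<^sup>2"
  by (simp add: norm_vec_def L2_set_def sum_nonneg cmod_power2 sum.distrib)

text \<open>A real matrix acts separately on real and imaginary parts, whose squared norms add
  up.\<close>

lemma norm_cmat_contraction:
  fixes K :: "real^'n^'n"
  assumes "\<And>x. norm (K *v x) \<le> norm x"
  shows "norm (cmat K *v y) \<le> norm y"
proof -
  have "(\<chi> i. Re ((cmat K *v y) $ i)) = K *v (\<chi> i. Re (y $ i))"
    "(\<chi> i. Im ((cmat K *v y) $ i)) = K *v (\<chi> i. Im (y $ i))"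
    by (simp_all add: matrix_vector_mult_def cmat_def vec_eq_iff)
  then have "(norm (cmat K *v y))\<^sup>2 \<le> (norm y)\<^sup>2"
    unfolding norm_complex_vec_power2[of "cmat K *v y"] norm_complex_vec_power2[of y]
    by (simp only:) (intro add_mono power_mono assms norm_ge_zero)
  then show ?thesis by (rule power2_le_imp_le) simp
qed

lemma orthogonal_matrix_norm:
  fixes U :: "real^'n^'n"
  shows "orthogonal_matrix U \<Longrightarrow> norm (U *v x) = norm x"
  unfolding orthogonal_matrix norm_eq
  by (metis dot_lmul_matrix inner_commute matrix_vector_mul_assoc matrix_vector_mul_lid transpose_matrix_vector)

text \<open>With \<open>T = S E\<close> one has \<open>S (z E - A) x = (z - K) T x\<close>.
  Eigenvectors and Jordan chains of the pencil thus become those of the contraction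
  \<open>K\<close>.\<close>

lemma admissible_if_similar_contraction:
  fixes E A S K :: "real^'n^'n"
  assumes E: "invertible E" and S: "invertible S"
    and K: "\<And>x. norm (K *v x) \<le> norm x" and eq: "S ** A = K ** S ** E"
  shows "admissible_pair E A"
proof -
  define T where "T = S ** E"
  have T: "invertible T" using E S by (simp add: T_def invertible_mult)
  note cK = norm_cmat_contraction[OF K]
  have cS: "cmat S *v (pencil_at E A z *v x) = z *s (cmat T *v x) - cmat K *v (cmat T *v x)" for z x
  proof -
    have "cmat S ** cmat A = cmat K ** cmat T"
      using eq by (metis T_def cmat_mult matrix_mul_assoc)
    then show ?thesis
      by (simp add: pencil_at_mult vec.diff vec.scale matrix_vector_mul_assoc T_def cmat_mult)
  qed
  have eig: "cmod z \<le> 1" if "finite_eigenvalue E A z" for z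
  proof -
    have "det (pencil_at E A z) = 0"
      using that by (simp add: finite_eigenvalue_def poly_pencil)
    then obtain x where x: "x \<noteq> 0" "pencil_at E A z *v x = 0"
      unfolding det_0_iff_kernel by blast
    then have "z *s (cmat T *v x) = cmat K *v (cmat T *v x)"
      using cS[of z x] by simp
    then have "cmod z * norm (cmat T *v x) \<le> norm (cmat T *v x)"
      using cK by (metis norm_scale_complex_vec)
    moreover have "0 < norm (cmat T *v x)" using inj_cmat[OF T] x(1) by auto
    ultimately show ?thesis by simp
  qed
  \<comment> \<open>The point 2 lies outside the closed unit disk, hence is not a root, and the
    pencil is regular.\<close>
  have nz: "pencil_poly E A \<noteq> 0"
    using eig[of 2] by (auto simp: finite_eigenvalue_def)
  have "semisimple_eigenvalue E A z" if z: "cmod z = 1" for z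
  proof (rule semisimpleI[OF nz])
    fix a w assume aw: "pencil_at E A z *v a = 0" "pencil_at E A z *v w = cmat E *v a"
    define a' w' where "a' = cmat T *v a" and "w' = cmat T *v w"
    have a': "cmat K *v a' = z *s a'"
      using cS[of z a] aw(1) by (simp add: a'_def)
    have w': "cmat K *v w' = z *s w' - a'"
      using cS[of z w] aw(2)
      by (simp add: a'_def w'_def T_def cmat_mult matrix_vector_mul_assoc[symmetric] algebra_simps)
    \<comment> \<open>The vector on the left is \<open>K^(k+1) w'\<close>, computed from the chain
      relations; a contraction keeps it bounded by \<open>w'\<close>.\<close>
    have bound: "norm (z ^ Suc k *s w' - (of_nat (Suc k) * z ^ k) *s a') \<le> norm w'" for k
    proof (induction k)
      case 0
      then show ?case using cK[of w'] w' by simp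
    next
      case (Suc k)
      have "cmat K *v (z ^ Suc k *s w' - (of_nat (Suc k) * z ^ k) *s a')
          = z ^ Suc k *s (z *s w' - a') - (of_nat (Suc k) * z ^ k) *s (z *s a')"
        by (simp only: vec.diff vec.scale a' w')
      also have "\<dots> = z ^ Suc (Suc k) *s w' - (of_nat (Suc (Suc k)) * z ^ Suc k) *s a'"
        by (simp add: vec_eq_iff algebra_simps)
      finally show ?case using order_trans[OF cK Suc.IH] by simp
    qed
    have tri: "norm a \<le> norm b + norm (b - a)" for a b :: "complex^'n"
      using norm_triangle_ineq4[of b "b - a"] by simp
    \<comment> \<open>As \<open>z\<close> has modulus one, the \<open>w'\<close> term has constant
      norm while the \<open>a'\<close> term grows linearly in \<open>k\<close>. Boundedness then
      forces \<open>a' = 0\<close>.\<close>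
    have suc: "real (Suc k) * norm a' \<le> 2 * norm w'" for k
    proof -
      have "real (Suc k) * norm a' = norm ((of_nat (Suc k) * z ^ k) *s a')"
        by (simp only: norm_scale_complex_vec norm_mult norm_power z norm_of_nat power_one mult_1_right)
      also have "\<dots> \<le> norm (z ^ Suc k *s w') + norm (z ^ Suc k *s w' - (of_nat (Suc k) * z ^ k) *s a')"
        by (rule tri)
      also have "norm (z ^ Suc k *s w') = norm w'"
        by (simp only: norm_scale_complex_vec norm_power z power_one mult_1_left)
      finally show ?thesis using bound[of k] by (simp only: mult_2)
    qed
    have le: "real k * norm a' \<le> 2 * norm w'" for k
      by (rule order_trans[OF mult_right_mono suc[of k]]) auto
    have "a' = 0"
    proof (rule ccontr)
      assume "a' \<noteq> 0"
      then obtain k where "2 * norm w' < real k * norm a'"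
        using reals_Archimedean3[of "norm a'"] by auto
      with le[of k] show False by simp
    qed
    then show "a = 0" using inj_cmat[OF T] by (simp add: a'_def)
  qed
  then show ?thesis
    using nz eig E by (simp add: admissible_pair_def regular_pair_def stable_pair_def pair_index_def)
qed

text \<open>Testing against the conjugate of \<open>z\<close> turns the bilinear pairing into the
  sum of the squared moduli.\<close>

lemma vector_eq_0_if_pairing_0:
  fixes z :: "complex^'n"
  assumes "\<And>v. (\<Sum>i\<in>UNIV. z $ i * v $ i) = 0"
  shows "z = 0"
proof -
  have "(\<Sum>i\<in>UNIV. z $ i * cnj (z $ i)) = 0"
    using assms[of "\<chi> i. cnj (z $ i)"] by simp
  then have "(\<Sum>i\<in>UNIV. complex_of_real ((cmod (z $ i))\<^sup>2)) = 0"
    by (simp only: complex_norm_square)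
  then have "(\<Sum>i\<in>UNIV. (cmod (z $ i))\<^sup>2) = 0"
    by (metis of_real_sum of_real_eq_0_iff)
  then show ?thesis by (simp add: sum_nonneg_eq_0_iff vec_eq_iff)
qed

lemma pairing_transpose:
  fixes N :: "'a::comm_semiring_1^'n^'n"
  shows "(\<Sum>i\<in>UNIV. (transpose N *v y) $ i * x $ i) = (\<Sum>i\<in>UNIV. y $ i * (N *v x) $ i)"
  unfolding matrix_vector_mult_def transpose_def
  by (simp add: sum_distrib_left sum_distrib_right) (subst sum.swap, simp add: mult_ac)

text \<open>Pairing carries the spectral hypotheses from the pencil to the transpose
  \<open>N\<close> of \<open>M = A E^(-1)\<close>. The resulting Stein inequality makes
  \<open>M\<close> a contraction for the \<open>P\<close>-inner product, and a
  \<open>P\<close>-orthonormal basis makes that inner product Euclidean.\<close>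

lemma similar_contraction_if_admissible:
  fixes E A :: "real^'n^'n"
  assumes E: "invertible E" and adm: "admissible_pair E A"
  obtains S K :: "real^'n^'n" where "invertible S" "\<forall>x. norm (K *v x) \<le> norm x"
    "A = matrix_inv S ** K ** S ** E"
proof -
  define M where "M = A ** matrix_inv E"
  define N where "N = transpose (cmat M)"
  have ME: "M ** E = A"
    using matrix_inv_cancel(2)[OF E] by (simp add: M_def matrix_mul_assoc[symmetric])
  have nz: "pencil_poly E A \<noteq> 0" and st: "stable_pair E A"
    using adm by (auto simp: admissible_pair_def regular_pair_def)
  let ?b = "\<lambda>y x::complex^'n. \<Sum>i\<in>UNIV. y $ i * x $ i"
  have bR: "?b y (pencil_at E A c *v x) = - ?b (N *v y - c *s y) (cmat E *v x)" for c x y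
  proof -
    have "cmat A *v x = cmat M *v (cmat E *v x)"
      by (simp add: matrix_vector_mul_assoc ME[symmetric] cmat_mult)
    then have "?b y (pencil_at E A c *v x) = c * ?b y (cmat E *v x) - ?b y (cmat M *v (cmat E *v x))"
      by (simp add: pencil_at_mult right_diff_distrib sum_subtractf sum_distrib_left mult_ac)
    also have "?b y (cmat M *v (cmat E *v x)) = ?b (N *v y) (cmat E *v x)"
      unfolding N_def pairing_transpose ..
    finally show ?thesis
      by (simp add: left_diff_distrib sum_subtractf sum_distrib_left mult.assoc)
  qed
  \<comment> \<open>Otherwise \<open>c E - A\<close> is surjective. By \<open>bR\<close> the
    functional \<open>z\<close> vanishes on its range, hence everywhere.\<close>
  have left: "finite_eigenvalue E A c" if z: "N *v z = c *s z" "z \<noteq> 0" for c z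
  proof (rule ccontr)
    assume "\<not> finite_eigenvalue E A c"
    then have "surj ((*v) (pencil_at E A c))"
      using invertible_det_nz[of "pencil_at E A c"] invertible_eq_bij[of "pencil_at E A c"]
      by (simp add: finite_eigenvalue_def poly_pencil bij_def)
    moreover have "?b z (pencil_at E A c *v x) = 0" for x
      unfolding bR z(1) by simp
    ultimately have "?b z v = 0" for v by (metis surjD)
    then show False using vector_eq_0_if_pairing_0[of z] z(2) by blast
  qed
  have "N *v u = c *s u" if c: "cmod c = 1" and u: "N *v (N *v u - c *s u) = c *s (N *v u - c *s u)" for c u
  proof (rule ccontr)
    assume ne: "N *v u \<noteq> c *s u"
    define z where "z = N *v u - c *s u"
    have z: "N *v z = c *s z" "z \<noteq> 0" using u ne by (auto simp: z_def)
    have "semisimple_eigenvalue E A c"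
      using left[OF z] c st by (simp add: stable_pair_def)
    \<comment> \<open>\<open>z\<close> vanishes on the range of \<open>c E - A\<close> because it is
      an eigenvector of \<open>N\<close>, and on \<open>E a\<close> for kernel vectors
      \<open>a\<close> because \<open>z = N u - c u\<close>. By \<open>semisimple_decomp\<close>
      these fill the space.\<close>
    then have "?b z v = 0" for v
    proof -
      obtain a w where aw: "pencil_at E A c *v a = 0" "v = cmat E *v a + pencil_at E A c *v w"
        using semisimple_decomp[OF nz \<open>semisimple_eigenvalue E A c\<close>] by metis
      have "?b z (cmat E *v a) = 0"
        using bR[of u c a] unfolding aw(1) z_def[symmetric] by simp
      moreover have "?b z (pencil_at E A c *v w) = 0"
        unfolding bR z(1) by simp
      ultimately show ?thesis
        unfolding aw(2) by (simp add: distrib_left sum.distrib)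
    qed
    then show False using vector_eq_0_if_pairing_0[of z] z(2) by blast
  qed
  moreover have "cmod c \<le> 1" if "N *v z = c *s z" "z \<noteq> 0" for c z
    using left[OF that] st by (simp add: stable_pair_def)
  ultimately obtain P :: "real^'n^'n" where P: "transpose P = P" "\<And>x. x \<noteq> 0 \<Longrightarrow> 0 < x \<bullet> (P *v x)"
    "\<And>x. (M *v x) \<bullet> (P *v (M *v x)) \<le> x \<bullet> (P *v x)"
    using stein_inequality_solvable[of M] unfolding N_def by metis
  obtain T :: "real^'n^'n" where T: "transpose T ** P ** T = mat 1"
    by (rule gram_schmidt_form[OF P(1,2)])
  \<comment> \<open>\<open>T^T P T = I\<close> says that \<open>T^T P\<close> is the inverse of
    \<open>T\<close>.\<close>
  define S where "S = transpose T ** P"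
  have ST: "S ** T = mat 1" using T by (simp add: S_def)
  then have TS: "T ** S = mat 1" using matrix_left_right_inverse by blast
  have S: "invertible S" using ST TS unfolding invertible_def by blast
  have invS: "matrix_inv S = T"
    using matrix_inv_cancel(2)[OF S] ST by (metis matrix_mul_assoc matrix_mul_lid matrix_mul_rid TS)
  define K where "K = S ** M ** T"
  have TK: "T ** K = M ** T"
    unfolding K_def using TS by (metis matrix_mul_assoc matrix_mul_lid)
  \<comment> \<open>\<open>T\<close> is an isometry from the Euclidean norm to the
    \<open>P\<close>-norm, so the bound for \<open>M\<close> becomes one for
    \<open>K\<close>.\<close>
  have form: "(T *v x) \<bullet> (P *v (T *v x)) = x \<bullet> x" for x
  proof -
    have "(T *v x) \<bullet> (P *v (T *v x)) = x \<bullet> (transpose T *v (P *v (T *v x)))"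
      by (metis dot_lmul_matrix inner_commute transpose_matrix_vector)
    also have "transpose T *v (P *v (T *v x)) = x"
      using T by (simp add: matrix_vector_mul_assoc matrix_mul_assoc del: transpose_matrix_vector)
    finally show ?thesis .
  qed
  have "norm (K *v x) \<le> norm x" for x
  proof -
    have "(K *v x) \<bullet> (K *v x) = (M *v (T *v x)) \<bullet> (P *v (M *v (T *v x)))"
      unfolding form[symmetric] by (simp add: matrix_vector_mul_assoc TK)
    also have "\<dots> \<le> (T *v x) \<bullet> (P *v (T *v x))" by (rule P(3))
    finally show ?thesis unfolding form by (simp add: norm_le)
  qed
  moreover have "A = matrix_inv S ** K ** S ** E"
    unfolding invS TK using TS ME by (metis matrix_mul_assoc matrix_mul_rid)
  ultimately show thesis using that[OF S, of K] by simp
qed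

theorem theorem4:
  fixes E A :: "real^'n^'n"
  assumes "invertible E"
  shows "admissible_pair E A \<longleftrightarrow>
    (\<exists>S U B :: real^'n^'n.
        invertible S \<and> transpose U ** U = mat 1 \<and>
        transpose B = B \<and> (\<forall>x. 0 \<le> x \<bullet> (B *v x)) \<and> spectral_norm B \<le> 1 \<and>
        A = matrix_inv S ** U ** B ** S ** E)"
proof
  assume "admissible_pair E A"
  then obtain S K :: "real^'n^'n" where S: "invertible S" and K: "\<forall>x. norm (K *v x) \<le> norm x"
    and A: "A = matrix_inv S ** K ** S ** E"
    by (rule similar_contraction_if_admissible[OF assms])
  obtain U B :: "real^'n^'n" where UB: "orthogonal_matrix U" "transpose B = B" "\<forall>x. 0 \<le> x \<bullet> (B *v x)" "K = U ** B"
    by (rule polar_decomposition[of K])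
  \<comment> \<open>\<open>U\<close> preserves norms, so the polar factor \<open>B\<close> has the
    same norm bound as \<open>K\<close>.\<close>
  have "norm (B *v x) \<le> 1 * norm x" for x
    using K[rule_format, of x] orthogonal_matrix_norm[OF UB(1), of "B *v x"]
    by (simp add: UB(4) matrix_vector_mul_assoc)
  then have "spectral_norm B \<le> 1"
    unfolding spectral_norm_def by (rule onorm_le)
  moreover have "A = matrix_inv S ** U ** B ** S ** E"
    unfolding A UB(4) by (simp add: matrix_mul_assoc)
  ultimately show "\<exists>S U B :: real^'n^'n.
        invertible S \<and> transpose U ** U = mat 1 \<and>
        transpose B = B \<and> (\<forall>x. 0 \<le> x \<bullet> (B *v x)) \<and> spectral_norm B \<le> 1 \<and>
        A = matrix_inv S ** U ** B ** S ** E"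
    using S UB unfolding orthogonal_matrix by (intro exI[of _ S] exI[of _ U] exI[of _ B]) simp
next
  assume "\<exists>S U B :: real^'n^'n.
        invertible S \<and> transpose U ** U = mat 1 \<and>
        transpose B = B \<and> (\<forall>x. 0 \<le> x \<bullet> (B *v x)) \<and> spectral_norm B \<le> 1 \<and>
        A = matrix_inv S ** U ** B ** S ** E"
  then obtain S U B :: "real^'n^'n" where S: "invertible S" and U: "orthogonal_matrix U"
    and B: "spectral_norm B \<le> 1" and A: "A = matrix_inv S ** U ** B ** S ** E"
    unfolding orthogonal_matrix by blast
  have "norm ((U ** B) *v x) \<le> norm x" for x
  proof -
    have "norm ((U ** B) *v x) = norm (B *v x)"
      using orthogonal_matrix_norm[OF U] by (simp add: matrix_vector_mul_assoc[symmetric])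
    also have "\<dots> \<le> spectral_norm B * norm x"
      unfolding spectral_norm_def by (intro onorm) simp
    also have "\<dots> \<le> norm x" using mult_right_mono[OF B norm_ge_zero, of x] by simp
    finally show ?thesis .
  qed
  moreover have "S ** A = (U ** B) ** S ** E"
    unfolding A by (simp add: matrix_mul_assoc matrix_inv_cancel(1)[OF S])
  ultimately show "admissible_pair E A"
    by (intro admissible_if_similar_contraction[OF assms S, of "U ** B"])
qed

end
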